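(* For every $\alpha \in (0,1]$, the set $\mathbf D_\alpha^\ast$ is a subsemigroup of $\mathbb S$ (under composition); that is, $\phi\circ\psi \in \mathbf D_\alpha^\ast$ whenever $\phi,\psi\in\mathbf D_\alpha^\ast$.
   Context: $\mathbb N$ is the set of positive integers. $\mathbb S$ is the semigroup (under composition) of strictly increasing functions $\mathbb N\to\mathbb N$. For $A\subseteq\mathbb N$ and $\alpha\in(0,1]$, the $\alpha$-density of $A$ is $\delta_\alpha(A)=\lim_{n\to\infty}\frac{\#(A\cap[1,n])}{n^\alpha}$, provided the limit exists. For $\phi\in\mathbb S$, $C_\phi=\mathbb N\setminus\{\phi(n):n\in\mathbb N\}$. For $\alpha\in(0,1]$, $\mathbf D_\alpha^\ast=\{\phi\in\mathbb S:\delta_\alpha(C_\phi)=0\}$. *)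

theory Defs
  imports Complex_Main "HOL-Library.FuncSet"
begin

abbreviation pos_nats :: "nat set"  (\<open>\<nat>\<^sub>+\<close>) where
  "\<nat>\<^sub>+ \<equiv> {1..}"

text \<open>
  A map from the positive integers to themselves is represented by an extensional function,
  i.e. one whose value at the junk argument 0 is fixed, so that equality of representatives is
  equality of maps. Accordingly, composition is \<^const>\<open>compose\<close> on \<open>\<nat>\<^sub>+\<close>.
\<close>

definition incr_maps :: "(nat \<Rightarrow> nat) set"  (\<open>\<S>\<close>) where
  "\<S> = {\<phi> \<in> \<nat>\<^sub>+ \<rightarrow>\<^sub>E \<nat>\<^sub>+. strict_mono_on \<nat>\<^sub>+ \<phi>}"

abbreviation comp_pos :: "(nat \<Rightarrow> nat) \<Rightarrow> (nat \<Rightarrow> nat) \<Rightarrow> nat \<Rightarrow> nat"  (infixl \<open>\<circ>\<^sub>+\<close> 55) where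
  "\<phi> \<circ>\<^sub>+ \<psi> \<equiv> compose \<nat>\<^sub>+ \<phi> \<psi>"

lemma incr_maps_comp_closed:
  assumes "\<phi> \<in> \<S>" "\<psi> \<in> \<S>"
  shows "\<phi> \<circ>\<^sub>+ \<psi> \<in> \<S>"
proof -
  have m: "\<phi> \<in> \<nat>\<^sub>+ \<rightarrow> \<nat>\<^sub>+" "\<psi> \<in> \<nat>\<^sub>+ \<rightarrow> \<nat>\<^sub>+"
    and mono: "strict_mono_on \<nat>\<^sub>+ \<phi>" "strict_mono_on \<nat>\<^sub>+ \<psi>"
    using assms by (auto simp: incr_maps_def)
  have "\<phi> \<circ>\<^sub>+ \<psi> \<in> \<nat>\<^sub>+ \<rightarrow>\<^sub>E \<nat>\<^sub>+"
    using funcset_compose[OF m(2,1)] by (simp add: PiE_def)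
  moreover have "strict_mono_on \<nat>\<^sub>+ (\<phi> \<circ>\<^sub>+ \<psi>)"
  proof (rule strict_mono_onI)
    fix a b :: nat assume ab: "a \<in> \<nat>\<^sub>+" "b \<in> \<nat>\<^sub>+" "a < b"
    have "\<phi> (\<psi> a) < \<phi> (\<psi> b)"
      using strict_mono_onD[OF mono(1) funcset_mem[OF m(2) ab(1)] funcset_mem[OF m(2) ab(2)]]
        strict_mono_onD[OF mono(2) ab] by blast
    then show "(\<phi> \<circ>\<^sub>+ \<psi>) a < (\<phi> \<circ>\<^sub>+ \<psi>) b"
      using ab by (simp add: compose_eq)
  qed
  ultimately show ?thesis
    by (simp add: incr_maps_def)
qed

lemma incr_maps_comp_assoc:
  assumes "\<phi> \<in> \<S>" "\<psi> \<in> \<S>" "\<chi> \<in> \<S>"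
  shows "(\<phi> \<circ>\<^sub>+ \<psi>) \<circ>\<^sub>+ \<chi> = \<phi> \<circ>\<^sub>+ (\<psi> \<circ>\<^sub>+ \<chi>)"
proof -
  have "\<chi> \<in> \<nat>\<^sub>+ \<rightarrow> \<nat>\<^sub>+"
    using assms by (auto simp: incr_maps_def)
  then show ?thesis
    by (intro extensionalityI[where A = "\<nat>\<^sub>+"]) (auto simp: compose_def)
qed

text \<open>Subsemigroups are nonempty, as usual.\<close>

definition subsemigroup :: "(nat \<Rightarrow> nat) set \<Rightarrow> bool" where
  "subsemigroup T \<longleftrightarrow> T \<noteq> {} \<and> T \<subseteq> \<S> \<and> (\<forall>\<phi>\<in>T. \<forall>\<psi>\<in>T. \<phi> \<circ>\<^sub>+ \<psi> \<in> T)"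

text \<open>
  The density is only defined when the limit exists, so it is rendered as a relation:
  the limit exists and equals \<open>d\<close>.
\<close>

definition has_density :: "real \<Rightarrow> nat set \<Rightarrow> real \<Rightarrow> bool" where
  "has_density \<alpha> A d \<longleftrightarrow>
     (\<lambda>n. real (card (A \<inter> {1..n})) / real n powr \<alpha>) \<longlonglongrightarrow> d"

definition omitted :: "(nat \<Rightarrow> nat) \<Rightarrow> nat set" where
  "omitted \<phi> = \<nat>\<^sub>+ - \<phi> ` \<nat>\<^sub>+"

definition D_star :: "real \<Rightarrow> (nat \<Rightarrow> nat) set" where
  "D_star \<alpha> = {\<phi> \<in> \<S>. has_density \<alpha> (omitted \<phi>) 0}"

end

theory Submission
  imports Defs
begin

text \<open>
  Since \<open>C\<^bsub>\<phi> \<circ> \<psi>\<^esub> = C\<^bsub>\<phi>\<^esub> \<union> \<phi>(C\<^bsub>\<psi>\<^esub>)\<close> and \<open>\<phi>(m) \<ge> m\<close>, the counting function of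
  \<open>C\<^bsub>\<phi> \<circ> \<psi>\<^esub>\<close> is at most the sum of those of \<open>C\<^bsub>\<phi>\<^esub>\<close> and \<open>C\<^bsub>\<psi>\<^esub>\<close>.
\<close>

text \<open>Values start at 1 or above, and each step of a strictly increasing map of naturals gains
  at least 1.\<close>

lemma incr_maps_ge:
  assumes "\<phi> \<in> \<S>" "1 \<le> m"
  shows "m \<le> \<phi> m"
  using assms(2)
proof (induction m rule: dec_induct)
  case base
  then show ?case
    using assms(1) by (auto simp: incr_maps_def PiE_def Pi_def)
next
  case (step m)
  have "\<phi> m < \<phi> (Suc m)"
    using assms(1) step.hyps by (auto simp: incr_maps_def intro: strict_mono_onD)
  then show ?case
    using step.IH by simp
qed

text \<open>If \<open>x = \<phi> y\<close> is missed by the composite, then \<open>y\<close> is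
  missed by \<open>\<psi>\<close>: from \<open>y = \<psi> z\<close> it would follow that
  \<open>x\<close> is the value of the composite at \<open>z\<close>.\<close>

lemma omitted_comp_subset:
  "omitted (\<phi> \<circ>\<^sub>+ \<psi>) \<subseteq> omitted \<phi> \<union> \<phi> ` omitted \<psi>"
proof
  fix x assume x: "x \<in> omitted (\<phi> \<circ>\<^sub>+ \<psi>)"
  show "x \<in> omitted \<phi> \<union> \<phi> ` omitted \<psi>"
  proof (cases "x \<in> \<phi> ` \<nat>\<^sub>+")
    case True
    then obtain y where y: "y \<in> \<nat>\<^sub>+" "x = \<phi> y"
      by blast
    have "y \<notin> \<psi> ` \<nat>\<^sub>+"
      using x y by (auto simp: omitted_def compose_eq image_iff)
    then show ?thesis
      using y by (auto simp: omitted_def)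
  next
    case False
    then show ?thesis
      using x by (simp add: omitted_def)
  qed
qed

lemma card_omitted_comp_le:
  assumes "\<phi> \<in> \<S>"
  shows "card (omitted (\<phi> \<circ>\<^sub>+ \<psi>) \<inter> {1..n})
    \<le> card (omitted \<phi> \<inter> {1..n}) + card (omitted \<psi> \<inter> {1..n})"
proof -
  let ?A = "omitted \<phi> \<inter> {1..n}" and ?B = "omitted \<psi> \<inter> {1..n}"
  have "omitted (\<phi> \<circ>\<^sub>+ \<psi>) \<inter> {1..n} \<subseteq> ?A \<union> \<phi> ` ?B"
  proof
    fix x assume x: "x \<in> omitted (\<phi> \<circ>\<^sub>+ \<psi>) \<inter> {1..n}"
    then consider "x \<in> omitted \<phi>" | y where "y \<in> omitted \<psi>" "x = \<phi> y"
      using omitted_comp_subset by blast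
    then show "x \<in> ?A \<union> \<phi> ` ?B"
    proof cases
      case 2
      have "1 \<le> y"
        using 2(1) by (simp add: omitted_def)
      \<comment> \<open>The cutoff survives pulling back along \<open>\<phi>\<close>, because
        \<open>y \<le> \<phi> y = x \<le> n\<close>.\<close>
      then have "y \<in> {1..n}"
        using incr_maps_ge[OF assms] 2(2) x by fastforce
      then show ?thesis
        using 2 by blast
    qed (use x in blast)
  qed
  then have "card (omitted (\<phi> \<circ>\<^sub>+ \<psi>) \<inter> {1..n}) \<le> card (?A \<union> \<phi> ` ?B)"
    by (intro card_mono) auto
  also have "\<dots> \<le> card ?A + card (\<phi> ` ?B)"
    by (rule card_Un_le)
  also have "\<dots> \<le> card ?A + card ?B"
    by (simp add: card_image_le)
  finally show ?thesis .
qed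

text \<open>Dividing the counting bound by \<open>real n powr \<alpha>\<close> squeezes the quotient
  of the composite between 0 and a sum of two null sequences.\<close>

lemma D_star_comp_closed:
  assumes "\<phi> \<in> D_star \<alpha>" "\<psi> \<in> D_star \<alpha>"
  shows "\<phi> \<circ>\<^sub>+ \<psi> \<in> D_star \<alpha>"
proof -
  define c where "c \<chi> n = real (card (omitted \<chi> \<inter> {1..n})) / real n powr \<alpha>" for \<chi> n
  have S: "\<phi> \<in> \<S>" "\<psi> \<in> \<S>" and lim: "c \<phi> \<longlonglongrightarrow> 0" "c \<psi> \<longlonglongrightarrow> 0"
    using assms by (auto simp: D_star_def has_density_def c_def[abs_def])
  have "c (\<phi> \<circ>\<^sub>+ \<psi>) \<longlonglongrightarrow> 0"
  proof (rule tendsto_sandwich[where f = "\<lambda>_. 0"])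
    show "\<forall>\<^sub>F n in sequentially. c (\<phi> \<circ>\<^sub>+ \<psi>) n \<le> c \<phi> n + c \<psi> n"
    \<comment> \<open>The bound holds for every \<open>n\<close>, including \<open>n = 0\<close>:
      there \<open>0 powr \<alpha> = 0\<close>, and division by zero makes all three quotients
      0.\<close>
    proof (rule always_eventually, rule allI)
      fix n
      have "real (card (omitted (\<phi> \<circ>\<^sub>+ \<psi>) \<inter> {1..n}))
          \<le> real (card (omitted \<phi> \<inter> {1..n})) + real (card (omitted \<psi> \<inter> {1..n}))"
        using card_omitted_comp_le[OF S(1), of \<psi> n] by linarith
      then show "c (\<phi> \<circ>\<^sub>+ \<psi>) n \<le> c \<phi> n + c \<psi> n"
        unfolding c_def add_divide_distrib[symmetric] by (rule divide_right_mono) simp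
    qed
    show "(\<lambda>n. c \<phi> n + c \<psi> n) \<longlonglongrightarrow> 0"
      using tendsto_add[OF lim] by simp
  qed (auto simp: c_def)
  then show ?thesis
    using incr_maps_comp_closed[OF S] by (simp add: D_star_def has_density_def c_def[abs_def])
qed

text \<open>This witnesses the nonemptiness demanded by \<open>subsemigroup\<close>. The restriction
  makes the identity extensional, as membership in \<open>\<S>\<close> requires.\<close>

lemma id_in_D_star: "restrict id \<nat>\<^sub>+ \<in> D_star \<alpha>"
proof -
  have "restrict id \<nat>\<^sub>+ \<in> \<S>"
    by (auto simp: incr_maps_def intro!: strict_mono_onI)
  moreover have "omitted (restrict id \<nat>\<^sub>+) = {}"
    by (auto simp: omitted_def)
  ultimately show ?thesis
    by (simp add: D_star_def has_density_def)
qed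

theorem theorem2p39:
  fixes \<alpha> :: real
  assumes "0 < \<alpha>" and "\<alpha> \<le> 1"
  shows "subsemigroup (D_star \<alpha>)"
  unfolding subsemigroup_def
  using id_in_D_star D_star_comp_closed by (auto simp: D_star_def)

end
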